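(* Let $(M^m,g)$, $(N^n,h)$ and $(Q^l,k)$ be Riemannian manifolds. (I) If $\phi:(M^m,g)\to(N^n,h)$ is a generalized harmonic morphism and $\varphi:(N^n,h)\to(Q^l,k)$ is a harmonic morphism, then $\varphi\circ\phi:(M^m,g)\to(Q^l,k)$ is a generalized harmonic morphism. (II) If $\phi:(M^m,g)\to(N^n,h)$ is a generalized harmonic morphism and $\psi:(Q^l,k)\to(M^m,g)$ is a biharmonic morphism, then $\phi\circ\psi:(Q^l,k)\to(N^n,h)$ is a generalized harmonic morphism.
   Context: All manifolds and maps are smooth. A function $u$ on (an open subset of) a Riemannian manifold is harmonic if $\Delta u=0$ and biharmonic if $\Delta(\Delta u)=0$, where $\Delta$ is the Laplace–Beltrami operator. Let $\phi:(M,g)\to(N,h)$ be a map between Riemannian manifolds. It is a harmonic morphism (respectively a generalized harmonic morphism) if for every harmonic function $f:U\to\mathbb{R}$ on an open set $U\subseteq N$ with $\phi^{-1}(U)$ non-empty, $f\circ\phi$ is harmonic (respectively biharmonic) on $\phi^{-1}(U)$. It is a biharmonic morphism if for every biharmonic function $f:U\to\mathbb{R}$ on an open set $U\subseteq N$ with $\phi^{-1}(U)$ non-empty, $f\circ\phi$ is biharmonic on $\phi^{-1}(U)$. *)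

theory Defs
  imports "HOL-Analysis.Analysis"
begin

text \<open>Both notions are meant for open \<open>S\<close>, where they depend only on the values of \<open>f\<close> on \<open>S\<close>.\<close>

fun k_smooth_on :: "nat \<Rightarrow> 'v::real_normed_vector set \<Rightarrow> ('v \<Rightarrow> 'w::real_normed_vector) \<Rightarrow> bool" where
  "k_smooth_on 0 S f \<longleftrightarrow> continuous_on S f"
| "k_smooth_on (Suc k) S f \<longleftrightarrow>
     (\<forall>x\<in>S. f differentiable (at x)) \<and>
     (\<forall>v. k_smooth_on k S (\<lambda>x. frechet_derivative f (at x) v))"

definition smooth_on :: "'v::real_normed_vector set \<Rightarrow> ('v \<Rightarrow> 'w::real_normed_vector) \<Rightarrow> bool" where
  "smooth_on S f \<longleftrightarrow> (\<forall>k. k_smooth_on k S f)"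

definition partial_deriv :: "'n::finite \<Rightarrow> (real ^ 'n \<Rightarrow> real) \<Rightarrow> real ^ 'n \<Rightarrow> real" where
  "partial_deriv i F z = frechet_derivative F (at z) (axis i 1)"

text \<open>The values of the coordinate map outside the domain are irrelevant. A manifold modelled on
  \<open>real ^ 'n\<close> has dimension \<open>CARD('n) \<ge> 1\<close>.\<close>

type_synonym ('a, 'n) chart = "'a set \<times> ('a \<Rightarrow> real ^ 'n)"

abbreviation chart_dom :: "('a, 'n) chart \<Rightarrow> 'a set" where
  "chart_dom \<equiv> fst"

abbreviation chart_map :: "('a, 'n) chart \<Rightarrow> 'a \<Rightarrow> real ^ 'n" where
  "chart_map \<equiv> snd"

definition chart_inv :: "('a, 'n) chart \<Rightarrow> real ^ 'n \<Rightarrow> 'a" where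
  "chart_inv c = inv_into (chart_dom c) (chart_map c)"

record ('a, 'n) manifold_data =
  mtop :: "'a topology"
  atlas :: "('a, 'n) chart set"

abbreviation points :: "('a, 'n) manifold_data \<Rightarrow> 'a set" where
  "points M \<equiv> topspace (mtop M)"

definition is_chart :: "'a topology \<Rightarrow> ('a, 'n::finite) chart \<Rightarrow> bool" where
  "is_chart X c \<longleftrightarrow>
     openin X (chart_dom c) \<and> open (chart_map c ` chart_dom c) \<and>
     homeomorphic_map (subtopology X (chart_dom c))
       (subtopology euclidean (chart_map c ` chart_dom c)) (chart_map c)"

text \<open>The atlas need not be maximal; every atlas determines a smooth structure.\<close>

definition smooth_manifold :: "('a, 'n::finite) manifold_data \<Rightarrow> bool" where
  "smooth_manifold M \<longleftrightarrow>
     Hausdorff_space (mtop M) \<and> second_countable (mtop M) \<and>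
     (\<forall>c\<in>atlas M. is_chart (mtop M) c) \<and>
     (\<Union>c\<in>atlas M. chart_dom c) = points M \<and>
     (\<forall>c\<in>atlas M. \<forall>d\<in>atlas M.
        smooth_on (chart_map c ` (chart_dom c \<inter> chart_dom d)) (chart_map d \<circ> chart_inv c))"

text \<open>A real-valued function on an open set \<open>U\<close> of points is represented by a function on the
  whole type; its values outside \<open>U\<close> are irrelevant.\<close>

definition smooth_fun_on :: "('a, 'n::finite) manifold_data \<Rightarrow> 'a set \<Rightarrow> ('a \<Rightarrow> real) \<Rightarrow> bool" where
  "smooth_fun_on M U u \<longleftrightarrow>
     (\<forall>c\<in>atlas M. smooth_on (chart_map c ` (chart_dom c \<inter> U)) (u \<circ> chart_inv c))"

definition smooth_map ::
    "('a, 'm::finite) manifold_data \<Rightarrow> ('b, 'n::finite) manifold_data \<Rightarrow> ('a \<Rightarrow> 'b) \<Rightarrow> bool" where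
  "smooth_map M N \<phi> \<longleftrightarrow>
     continuous_map (mtop M) (mtop N) \<phi> \<and>
     (\<forall>c\<in>atlas M. \<forall>d\<in>atlas N.
        smooth_on (chart_map c ` (chart_dom c \<inter> \<phi> -` chart_dom d))
          (chart_map d \<circ> \<phi> \<circ> chart_inv c))"

text \<open>Smooth functions on \<open>M\<close> are normalized to be \<open>0\<close> outside \<open>M\<close>, and tangent vectors (the
  derivations at a point) to be \<open>0\<close> outside \<open>C_inf M\<close>, so that equality of functions and of
  tangent vectors is equality in HOL.\<close>

definition C_inf :: "('a, 'n::finite) manifold_data \<Rightarrow> ('a \<Rightarrow> real) set" where
  "C_inf M = {f. smooth_fun_on M (points M) f \<and> (\<forall>p. p \<notin> points M \<longrightarrow> f p = 0)}"

type_synonym 'a tangent = "('a \<Rightarrow> real) \<Rightarrow> real"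

definition tangent_space :: "('a, 'n::finite) manifold_data \<Rightarrow> 'a \<Rightarrow> 'a tangent set" where
  "tangent_space M p =
     {v. (\<forall>f\<in>C_inf M. \<forall>h\<in>C_inf M. \<forall>a b. v (\<lambda>q. a * f q + b * h q) = a * v f + b * v h) \<and>
         (\<forall>f\<in>C_inf M. \<forall>h\<in>C_inf M. v (\<lambda>q. f q * h q) = f p * v h + h p * v f) \<and>
         (\<forall>f. f \<notin> C_inf M \<longrightarrow> v f = 0)}"

definition coord_vector ::
    "('a, 'n::finite) manifold_data \<Rightarrow> ('a, 'n) chart \<Rightarrow> 'n \<Rightarrow> 'a \<Rightarrow> 'a tangent" where
  "coord_vector M c i p =
     (\<lambda>f. if f \<in> C_inf M then partial_deriv i (f \<circ> chart_inv c) (chart_map c p) else 0)"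

type_synonym 'a metric_field = "'a \<Rightarrow> 'a tangent \<Rightarrow> 'a tangent \<Rightarrow> real"

definition inner_product_on :: "'a tangent set \<Rightarrow> ('a tangent \<Rightarrow> 'a tangent \<Rightarrow> real) \<Rightarrow> bool" where
  "inner_product_on T b \<longleftrightarrow>
     (\<forall>v\<in>T. \<forall>w\<in>T. b v w = b w v) \<and>
     (\<forall>u\<in>T. \<forall>v\<in>T. \<forall>w\<in>T. \<forall>r s. b (\<lambda>f. r * u f + s * v f) w = r * b u w + s * b v w) \<and>
     (\<forall>v\<in>T. v \<noteq> (\<lambda>f. 0) \<longrightarrow> b v v > 0)"

definition metric_matrix ::
    "('a, 'n::finite) manifold_data \<Rightarrow> 'a metric_field \<Rightarrow> ('a, 'n) chart \<Rightarrow> 'a \<Rightarrow> real ^ 'n ^ 'n" where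
  "metric_matrix M g c p = (\<chi> i j. g p (coord_vector M c i p) (coord_vector M c j p))"

definition riemannian_manifold ::
    "('a, 'n::finite) manifold_data \<Rightarrow> 'a metric_field \<Rightarrow> bool" where
  "riemannian_manifold M g \<longleftrightarrow>
     smooth_manifold M \<and>
     (\<forall>p\<in>points M. inner_product_on (tangent_space M p) (g p)) \<and>
     (\<forall>c\<in>atlas M. \<forall>i j.
        smooth_on (chart_map c ` chart_dom c) (\<lambda>z. metric_matrix M g c (chart_inv c z) $ i $ j))"

definition laplacian_in_chart ::
    "('a, 'n::finite) manifold_data \<Rightarrow> 'a metric_field \<Rightarrow> ('a, 'n) chart \<Rightarrow>
       ('a \<Rightarrow> real) \<Rightarrow> 'a \<Rightarrow> real" where
  "laplacian_in_chart M g c u p =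
     (let G = (\<lambda>z. metric_matrix M g c (chart_inv c z));
          w = (\<lambda>z. sqrt (det (G z)))
      in (1 / w (chart_map c p)) *
         (\<Sum>i\<in>UNIV. partial_deriv i
            (\<lambda>z. w z * (\<Sum>j\<in>UNIV. matrix_inv (G z) $ i $ j * partial_deriv j (u \<circ> chart_inv c) z))
            (chart_map c p)))"

text \<open>The local expression at \<open>p\<close> is the same in all charts around \<open>p\<close>, provided that \<open>u\<close> is
  smooth near \<open>p\<close>; hence the choice of the chart does not matter.\<close>

definition laplacian ::
    "('a, 'n::finite) manifold_data \<Rightarrow> 'a metric_field \<Rightarrow> ('a \<Rightarrow> real) \<Rightarrow> 'a \<Rightarrow> real" where
  "laplacian M g u p = laplacian_in_chart M g (SOME c. c \<in> atlas M \<and> p \<in> chart_dom c) u p"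

definition harmonic_on ::
    "('a, 'n::finite) manifold_data \<Rightarrow> 'a metric_field \<Rightarrow> 'a set \<Rightarrow> ('a \<Rightarrow> real) \<Rightarrow> bool" where
  "harmonic_on M g U u \<longleftrightarrow> smooth_fun_on M U u \<and> (\<forall>p\<in>U. laplacian M g u p = 0)"

definition biharmonic_on ::
    "('a, 'n::finite) manifold_data \<Rightarrow> 'a metric_field \<Rightarrow> 'a set \<Rightarrow> ('a \<Rightarrow> real) \<Rightarrow> bool" where
  "biharmonic_on M g U u \<longleftrightarrow>
     smooth_fun_on M U u \<and> (\<forall>p\<in>U. laplacian M g (laplacian M g u) p = 0)"

definition preimage_in :: "('a, 'm) manifold_data \<Rightarrow> ('a \<Rightarrow> 'b) \<Rightarrow> 'b set \<Rightarrow> 'a set" where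
  "preimage_in M \<phi> U = {p \<in> points M. \<phi> p \<in> U}"

definition harmonic_morphism ::
    "('a, 'm::finite) manifold_data \<Rightarrow> 'a metric_field \<Rightarrow>
     ('b, 'n::finite) manifold_data \<Rightarrow> 'b metric_field \<Rightarrow> ('a \<Rightarrow> 'b) \<Rightarrow> bool" where
  "harmonic_morphism M g N h \<phi> \<longleftrightarrow>
     smooth_map M N \<phi> \<and>
     (\<forall>U f. openin (mtop N) U \<longrightarrow> preimage_in M \<phi> U \<noteq> {} \<longrightarrow> harmonic_on N h U f \<longrightarrow>
        harmonic_on M g (preimage_in M \<phi> U) (f \<circ> \<phi>))"

definition generalized_harmonic_morphism ::
    "('a, 'm::finite) manifold_data \<Rightarrow> 'a metric_field \<Rightarrow>
     ('b, 'n::finite) manifold_data \<Rightarrow> 'b metric_field \<Rightarrow> ('a \<Rightarrow> 'b) \<Rightarrow> bool" where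
  "generalized_harmonic_morphism M g N h \<phi> \<longleftrightarrow>
     smooth_map M N \<phi> \<and>
     (\<forall>U f. openin (mtop N) U \<longrightarrow> preimage_in M \<phi> U \<noteq> {} \<longrightarrow> harmonic_on N h U f \<longrightarrow>
        biharmonic_on M g (preimage_in M \<phi> U) (f \<circ> \<phi>))"

definition biharmonic_morphism ::
    "('a, 'm::finite) manifold_data \<Rightarrow> 'a metric_field \<Rightarrow>
     ('b, 'n::finite) manifold_data \<Rightarrow> 'b metric_field \<Rightarrow> ('a \<Rightarrow> 'b) \<Rightarrow> bool" where
  "biharmonic_morphism M g N h \<phi> \<longleftrightarrow>
     smooth_map M N \<phi> \<and>
     (\<forall>U f. openin (mtop N) U \<longrightarrow> preimage_in M \<phi> U \<noteq> {} \<longrightarrow> biharmonic_on N h U f \<longrightarrow>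
        biharmonic_on M g (preimage_in M \<phi> U) (f \<circ> \<phi>))"

end

theory Submission
  imports Defs
begin

text \<open>Pulling functions back along maps is contravariantly functorial: \<open>f \<circ> (\<phi>' \<circ> \<phi>)\<close> is
  \<open>(f \<circ> \<phi>') \<circ> \<phi>\<close>, and its domain is the \<open>\<phi>\<close>-preimage of the \<open>\<phi>'\<close>-preimage of the domain of \<open>f\<close>.
  A morphism of one of the three kinds carries functions of one class (harmonic or biharmonic) to
  functions of another, so two morphisms compose as soon as the class produced by the outer one is
  the class accepted by the inner one. In (I) a harmonic \<open>f\<close> stays harmonic under \<open>\<phi>'\<close> and becomes
  biharmonic under \<open>\<phi>\<close>; in (II) it becomes biharmonic under \<open>\<phi>\<close> and stays so under \<open>\<psi>\<close>.
  The intermediate open set is non-empty because the final one is.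

  The substance lies in the smoothness of the composite map (\<open>smooth_map_comp\<close>). Near a point its
  coordinate expression factors, through any chart of the middle manifold, as a composite of two
  smooth maps between open sets of Euclidean spaces. Smoothness being a local property
  (\<open>k_smooth_on_local\<close>), this reduces to the Euclidean chain rule of order \<open>k\<close>
  (\<open>k_smooth_on_compose\<close>). There the derivative of \<open>g \<circ> f\<close> in a direction is expanded in a basis,
  as a sum of products of derivatives of \<open>f\<close> with derivatives of \<open>g\<close> evaluated along \<open>f\<close>; each
  factor has one order of smoothness less, and induction on \<open>k\<close> applies together with the closure
  of \<open>C\<^sup>k\<close> functions under products.\<close>

section \<open>Functions of class \<open>C\<^sup>k\<close> between normed spaces\<close>

lemma k_smooth_on_subset:
  "k_smooth_on k S f \<Longrightarrow> T \<subseteq> S \<Longrightarrow> k_smooth_on k T f"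
  by (induction k arbitrary: f) (auto intro: continuous_on_subset)

lemma k_smooth_on_SucD:
  "k_smooth_on (Suc k) S f \<Longrightarrow> k_smooth_on k S f"
proof (induction k arbitrary: f)
  case 0
  then show ?case
    by (auto intro!: continuous_at_imp_continuous_on differentiable_imp_continuous_within)
next
  case (Suc k)
  then show ?case
    by (metis k_smooth_on.simps(2))
qed

lemma k_smooth_on_cong:
  assumes "k_smooth_on k S f" "open S" "\<And>x. x \<in> S \<Longrightarrow> f x = g x"
  shows "k_smooth_on k S g"
  using assms
proof (induction k arbitrary: f g)
  case 0
  then show ?case
    by (metis continuous_on_cong k_smooth_on.simps(1))
next
  case (Suc k)
  have der: "(g has_derivative frechet_derivative f (at x)) (at x)" if "x \<in> S" for x
  proof (rule has_derivative_transform_within_open[OF _ \<open>open S\<close> that])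
    show "(f has_derivative frechet_derivative f (at x)) (at x)"
      using Suc.prems(1) that by (simp add: frechet_derivative_works)
  qed (use Suc.prems in auto)
  have "k_smooth_on k S (\<lambda>x. frechet_derivative g (at x) v)" for v
  proof (rule Suc.IH)
    show "k_smooth_on k S (\<lambda>x. frechet_derivative f (at x) v)"
      using Suc.prems(1) by simp
  qed (use Suc.prems(2) der frechet_derivative_at in metis)+
  then show ?case
    using der by (auto simp: differentiable_def)
qed

lemma k_smooth_on_local:
  assumes "\<And>x. x \<in> S \<Longrightarrow> \<exists>T. open T \<and> x \<in> T \<and> k_smooth_on k T f"
  shows "k_smooth_on k S f"
  using assms
proof (induction k arbitrary: f)
  case 0
  then show ?case
    by (auto intro!: continuous_at_imp_continuous_on simp: continuous_on_eq_continuous_at)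
       (metis continuous_on_eq_continuous_at)
next
  case (Suc k)
  have "k_smooth_on k S (\<lambda>x. frechet_derivative f (at x) v)" for v
    by (rule Suc.IH) (use Suc.prems in force)
  then show ?case
    using Suc.prems by fastforce
qed

text \<open>Any formula for the derivative can be used to test smoothness; on an open set it may be
  exchanged with the Frechet derivative without affecting the higher derivatives.\<close>

lemma k_smooth_on_SucI:
  assumes "open S"
    and "\<And>x. x \<in> S \<Longrightarrow> (f has_derivative f' x) (at x)"
    and "\<And>v. k_smooth_on k S (\<lambda>x. f' x v)"
  shows "k_smooth_on (Suc k) S f"
proof -
  have "k_smooth_on k S (\<lambda>x. frechet_derivative f (at x) v)" for v
    by (rule k_smooth_on_cong[OF assms(3)[of v] \<open>open S\<close>])
       (use assms(2) frechet_derivative_at in metis)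
  then show ?thesis
    using assms(2) by (auto simp: differentiable_def)
qed

lemma k_smooth_on_SucE:
  assumes "k_smooth_on (Suc k) S f"
  shows "x \<in> S \<Longrightarrow> (f has_derivative frechet_derivative f (at x)) (at x)"
    and "k_smooth_on k S (\<lambda>x. frechet_derivative f (at x) v)"
  using assms by (auto simp: frechet_derivative_works)

lemma k_smooth_on_const:
  "open S \<Longrightarrow> k_smooth_on k S (\<lambda>x. c)"
proof (induction k arbitrary: c)
  case (Suc k)
  then show ?case
    by (intro k_smooth_on_SucI[where f' = "\<lambda>x v. 0"]) auto
qed auto

lemma k_smooth_on_add:
  assumes "open S" "k_smooth_on k S f" "k_smooth_on k S g"
  shows "k_smooth_on k S (\<lambda>x. f x + g x)"
  using assms(2,3)
proof (induction k arbitrary: f g)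
  case (Suc k)
  show ?case
    by (rule k_smooth_on_SucI[OF \<open>open S\<close> has_derivative_add[OF k_smooth_on_SucE(1) k_smooth_on_SucE(1)]])
       (use Suc in \<open>blast intro: k_smooth_on_SucE\<close>)+
qed (auto intro: continuous_on_add)

lemma k_smooth_on_sum:
  assumes "open S" "\<And>i. i \<in> I \<Longrightarrow> k_smooth_on k S (f i)"
  shows "k_smooth_on k S (\<lambda>x. \<Sum>i\<in>I. f i x)"
  using assms(2)
  by (induction I rule: infinite_finite_induct)
     (auto intro: k_smooth_on_add k_smooth_on_const assms(1))

text \<open>The Leibniz rule has one factor differentiated in each summand, so both summands are products
  of \<open>C\<^sup>k\<close> functions when the factors are \<open>C\<^sup>k\<^sup>+\<^sup>1\<close>.\<close>

lemma (in bounded_bilinear) k_smooth_on_prod: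
  assumes "open S" "k_smooth_on k S f" "k_smooth_on k S g"
  shows "k_smooth_on k S (\<lambda>x. prod (f x) (g x))"
  using assms(2,3)
proof (induction k arbitrary: f g)
  case 0
  then show ?case
    by (auto intro: continuous_on)
next
  case (Suc k)
  show ?case
  proof (rule k_smooth_on_SucI[OF \<open>open S\<close> FDERIV[OF k_smooth_on_SucE(1) k_smooth_on_SucE(1)]])
    show "k_smooth_on k S (\<lambda>x. prod (f x) (frechet_derivative g (at x) v) +
        prod (frechet_derivative f (at x) v) (g x))" for v
      using Suc.prems by (intro k_smooth_on_add Suc.IH \<open>open S\<close>)
        (auto intro: k_smooth_on_SucD k_smooth_on_SucE)
  qed (use Suc.prems in blast)+
qed

text \<open>The class \<open>C\<^sup>k\<close> is defined through derivatives in fixed directions, whereas the chain rule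
  differentiates \<open>g\<close> in the direction \<open>Df(x)v\<close>, which varies with \<open>x\<close>. Expanding this direction in
  a basis leaves derivatives of \<open>g\<close> in the basis directions only, which is why the middle space is
  Euclidean.\<close>

lemma k_smooth_on_compose:
  fixes f :: "'u::real_normed_vector \<Rightarrow> 'v::euclidean_space"
    and g :: "'v \<Rightarrow> 'w::real_normed_vector"
  assumes "open S" "f ` S \<subseteq> T" "k_smooth_on k S f" "k_smooth_on k T g"
  shows "k_smooth_on k S (g \<circ> f)"
  using assms(3,4)
proof (induction k arbitrary: g)
  case 0
  then show ?case
    using assms(2)
    by (simp only: k_smooth_on.simps) (meson continuous_on_compose continuous_on_subset)
next
  case (Suc k)
  define Df where "Df x = frechet_derivative f (at x)" for x
  define Dg where "Dg y = frechet_derivative g (at y)" for y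
  have Df: "(f has_derivative Df x) (at x)" if "x \<in> S" for x
    unfolding Df_def using k_smooth_on_SucE(1)[OF Suc.prems(1) that] .
  have Dg: "(g has_derivative Dg (f x)) (at (f x))" if "x \<in> S" for x
    unfolding Dg_def using k_smooth_on_SucE(1)[OF Suc.prems(2)] that assms(2) by auto
  show ?case
  proof (rule k_smooth_on_SucI[OF \<open>open S\<close>])
    show "(g \<circ> f has_derivative Dg (f x) \<circ> Df x) (at x)" if "x \<in> S" for x
      using diff_chain_at[OF Df[OF that] Dg[OF that]] .
  next
    fix v
    have "k_smooth_on k S (\<lambda>x. \<Sum>b\<in>Basis. (Df x v \<bullet> b) *\<^sub>R ((\<lambda>y. Dg y b) \<circ> f) x)"
    proof (rule k_smooth_on_sum[OF \<open>open S\<close>])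
      fix b :: 'v
      have "k_smooth_on k S (\<lambda>x. Df x v \<bullet> b)"
        unfolding Df_def
        by (intro bounded_bilinear.k_smooth_on_prod[OF bounded_bilinear_inner] \<open>open S\<close>
              k_smooth_on_const k_smooth_on_SucE(2)[OF Suc.prems(1)])
      moreover have "k_smooth_on k S ((\<lambda>y. Dg y b) \<circ> f)"
        unfolding Dg_def
        by (intro Suc.IH k_smooth_on_SucD[OF Suc.prems(1)] k_smooth_on_SucE(2)[OF Suc.prems(2)])
      ultimately show "k_smooth_on k S (\<lambda>x. (Df x v \<bullet> b) *\<^sub>R ((\<lambda>y. Dg y b) \<circ> f) x)"
        by (intro bounded_bilinear.k_smooth_on_prod[OF bounded_bilinear_scaleR] \<open>open S\<close>)
    qed
    moreover have "(\<Sum>b\<in>Basis. (Df x v \<bullet> b) *\<^sub>R ((\<lambda>y. Dg y b) \<circ> f) x) = (Dg (f x) \<circ> Df x) v"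
      if "x \<in> S" for x
    proof -
      interpret linear "Dg (f x)"
        using Dg[OF that] by (rule has_derivative_linear)
      have "Dg (f x) (Df x v) = Dg (f x) (\<Sum>b\<in>Basis. (Df x v \<bullet> b) *\<^sub>R b)"
        by (simp add: euclidean_representation)
      then show ?thesis
        by (simp add: sum scale)
    qed
    ultimately show "k_smooth_on k S (\<lambda>x. (Dg (f x) \<circ> Df x) v)"
      by (rule k_smooth_on_cong[OF _ \<open>open S\<close>])
  qed
qed

section \<open>Composition of smooth maps between manifolds\<close>

lemma chart_image_open:
  assumes "is_chart X c" "openin X W" "W \<subseteq> chart_dom c"
  shows "open (chart_map c ` W)"
proof -
  have "open_map (subtopology X (chart_dom c))
      (subtopology euclidean (chart_map c ` chart_dom c)) (chart_map c)"
    using assms(1) by (auto simp: is_chart_def homeomorphic_imp_open_map)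
  moreover have "openin (subtopology X (chart_dom c)) W"
    using assms by (auto simp: is_chart_def openin_open_subtopology)
  ultimately have "openin (subtopology euclidean (chart_map c ` chart_dom c)) (chart_map c ` W)"
    by (auto simp: open_map_def)
  then show ?thesis
    using assms(1) by (auto simp: is_chart_def openin_open_eq)
qed

lemma chart_inv_chart_map:
  assumes "is_chart X c" "p \<in> chart_dom c"
  shows "chart_inv c (chart_map c p) = p"
proof -
  have "topspace (subtopology X (chart_dom c)) = chart_dom c"
    using assms(1) by (auto simp: is_chart_def dest: openin_subset)
  then have "inj_on (chart_map c) (chart_dom c)"
    using assms(1) homeomorphic_imp_injective_map by (fastforce simp: is_chart_def)
  then show ?thesis
    using assms(2) by (simp add: chart_inv_def)
qed

lemma openin_preimage_in:
  "continuous_map (mtop M) (mtop N) \<phi> \<Longrightarrow> openin (mtop N) U \<Longrightarrow> openin (mtop M) (preimage_in M \<phi> U)"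
  unfolding preimage_in_def by (rule openin_continuous_map_preimage)

lemma preimage_in_comp:
  "continuous_map (mtop M) (mtop N) \<phi> \<Longrightarrow>
    preimage_in M (\<phi>' \<circ> \<phi>) U = preimage_in M \<phi> (preimage_in N \<phi>' U)"
  by (auto simp: preimage_in_def continuous_map_def)

text \<open>A single chart of the middle manifold cannot serve the whole coordinate domain, because
  its preimage may cover only part of it; hence the passage to a neighbourhood of each point.\<close>

lemma smooth_map_comp:
  assumes M: "smooth_manifold M" and N: "smooth_manifold N"
    and \<phi>: "smooth_map M N \<phi>" and \<phi>': "smooth_map N Q \<phi>'"
    and Q: "smooth_manifold Q"
  shows "smooth_map M Q (\<phi>' \<circ> \<phi>)"
  unfolding smooth_map_def
proof (intro conjI ballI)
  have cont: "continuous_map (mtop M) (mtop N) \<phi>" "continuous_map (mtop N) (mtop Q) \<phi>'"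
    using \<phi> \<phi>' by (auto simp: smooth_map_def)
  then show "continuous_map (mtop M) (mtop Q) (\<phi>' \<circ> \<phi>)"
    by (rule continuous_map_compose)
  fix c e
  assume c: "c \<in> atlas M" and e: "e \<in> atlas Q"
  have chart_c: "is_chart (mtop M) c" and chart_e: "is_chart (mtop Q) e"
    using M c Q e by (auto simp: smooth_manifold_def)
  have c_sub: "chart_dom c \<subseteq> points M"
    using chart_c by (auto simp: is_chart_def dest: openin_subset)
  show "smooth_on (chart_map c ` (chart_dom c \<inter> (\<phi>' \<circ> \<phi>) -` chart_dom e))
      (chart_map e \<circ> (\<phi>' \<circ> \<phi>) \<circ> chart_inv c)"
    unfolding smooth_on_def
  proof (intro allI k_smooth_on_local)
    fix k z
    assume "z \<in> chart_map c ` (chart_dom c \<inter> (\<phi>' \<circ> \<phi>) -` chart_dom e)"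
    then obtain p where p: "p \<in> chart_dom c" "\<phi>' (\<phi> p) \<in> chart_dom e" "z = chart_map c p"
      by auto
    then have "\<phi> p \<in> points N"
      using c_sub cont(1) by (auto simp: continuous_map_def)
    then obtain d where d: "d \<in> atlas N" "\<phi> p \<in> chart_dom d"
      using N unfolding smooth_manifold_def by blast
    have chart_d: "is_chart (mtop N) d"
      using N d by (auto simp: smooth_manifold_def)
    have d_sub: "chart_dom d \<subseteq> points N"
      using chart_d by (auto simp: is_chart_def dest: openin_subset)
    define V where "V = chart_dom d \<inter> \<phi>' -` chart_dom e"
    define W where "W = chart_dom c \<inter> \<phi> -` V"
    have "V = chart_dom d \<inter> preimage_in N \<phi>' (chart_dom e)"
      using d_sub by (auto simp: V_def preimage_in_def)
    then have "openin (mtop N) V"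
      using openin_preimage_in[OF cont(2)] chart_d chart_e by (auto simp: is_chart_def)
    moreover have "W = chart_dom c \<inter> preimage_in M \<phi> V"
      using c_sub by (auto simp: W_def preimage_in_def)
    ultimately have "openin (mtop M) W"
      using openin_preimage_in[OF cont(1)] chart_c by (auto simp: is_chart_def)
    then have W: "open (chart_map c ` W)"
      by (rule chart_image_open[OF chart_c]) (auto simp: W_def)
    let ?F = "chart_map d \<circ> \<phi> \<circ> chart_inv c" and ?G = "chart_map e \<circ> \<phi>' \<circ> chart_inv d"
    have "k_smooth_on k (chart_map c ` W) (?G \<circ> ?F)"
    proof (rule k_smooth_on_compose[OF W])
      show "?F ` chart_map c ` W \<subseteq> chart_map d ` V"
        by (auto simp: W_def chart_inv_chart_map[OF chart_c])
      have "k_smooth_on k (chart_map c ` (chart_dom c \<inter> \<phi> -` chart_dom d)) ?F"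
        using \<phi> c d by (auto simp: smooth_map_def smooth_on_def)
      then show "k_smooth_on k (chart_map c ` W) ?F"
        by (rule k_smooth_on_subset) (auto simp: W_def V_def)
      show "k_smooth_on k (chart_map d ` V) ?G"
        using \<phi>' d e by (auto simp: smooth_map_def smooth_on_def V_def)
    qed
    then have "k_smooth_on k (chart_map c ` W) (chart_map e \<circ> (\<phi>' \<circ> \<phi>) \<circ> chart_inv c)"
      by (rule k_smooth_on_cong[OF _ W])
         (auto simp: W_def V_def chart_inv_chart_map[OF chart_c] chart_inv_chart_map[OF chart_d])
    moreover have "z \<in> chart_map c ` W"
      using p d by (auto simp: W_def V_def)
    ultimately show "\<exists>T. open T \<and> z \<in> T \<and>
        k_smooth_on k T (chart_map e \<circ> (\<phi>' \<circ> \<phi>) \<circ> chart_inv c)"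
      using W by blast
  qed
qed

section \<open>Composition of morphisms\<close>

text \<open>Both parts of the theorem are instances: in (I) the classes \<open>A\<close>, \<open>B\<close>, \<open>C\<close> are harmonic,
  harmonic, biharmonic; in (II) they are harmonic, biharmonic, biharmonic.\<close>

lemma pullback_comp:
  assumes \<phi>: "continuous_map (mtop M) (mtop N) \<phi>" and \<phi>': "continuous_map (mtop N) (mtop Q) \<phi>'"
    and outer: "\<And>U f. openin (mtop Q) U \<Longrightarrow> preimage_in N \<phi>' U \<noteq> {} \<Longrightarrow> A U f \<Longrightarrow>
      B (preimage_in N \<phi>' U) (f \<circ> \<phi>')"
    and inner: "\<And>U f. openin (mtop N) U \<Longrightarrow> preimage_in M \<phi> U \<noteq> {} \<Longrightarrow> B U f \<Longrightarrow>
      C (preimage_in M \<phi> U) (f \<circ> \<phi>)"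
    and U: "openin (mtop Q) U" "preimage_in M (\<phi>' \<circ> \<phi>) U \<noteq> {}" "A U f"
  shows "C (preimage_in M (\<phi>' \<circ> \<phi>) U) (f \<circ> (\<phi>' \<circ> \<phi>))"
proof -
  note eq = preimage_in_comp[OF \<phi>, of \<phi>' U]
  have "preimage_in N \<phi>' U \<noteq> {}"
    using U(2) unfolding eq by (auto simp: preimage_in_def)
  then have "B (preimage_in N \<phi>' U) (f \<circ> \<phi>')"
    using U by (intro outer)
  then have "C (preimage_in M \<phi> (preimage_in N \<phi>' U)) ((f \<circ> \<phi>') \<circ> \<phi>)"
    using U(2) unfolding eq by (intro inner openin_preimage_in[OF \<phi>'] U(1))
  then show ?thesis
    by (simp add: eq comp_assoc)
qed

theorem corollary3p1:
  fixes M :: "('a, 'm::finite) manifold_data" and g :: "'a metric_field"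
    and N :: "('b, 'n::finite) manifold_data" and h :: "'b metric_field"
    and Q :: "('c, 'l::finite) manifold_data" and k :: "'c metric_field"
  assumes "riemannian_manifold M g"
    and "riemannian_manifold N h"
    and "riemannian_manifold Q k"
  shows
    "(\<forall>\<phi> \<phi>'. generalized_harmonic_morphism M g N h \<phi> \<longrightarrow>
        harmonic_morphism N h Q k \<phi>' \<longrightarrow>
        generalized_harmonic_morphism M g Q k (\<phi>' \<circ> \<phi>)) \<and>
     (\<forall>\<phi> \<psi>. generalized_harmonic_morphism M g N h \<phi> \<longrightarrow>
        biharmonic_morphism Q k M g \<psi> \<longrightarrow>
        generalized_harmonic_morphism Q k N h (\<phi> \<circ> \<psi>))"
proof (intro conjI allI impI)
  have man: "smooth_manifold M" "smooth_manifold N" "smooth_manifold Q"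
    using assms by (auto simp: riemannian_manifold_def)
  {
    fix \<phi> \<phi>'
    assume \<phi>: "generalized_harmonic_morphism M g N h \<phi>" and \<phi>': "harmonic_morphism N h Q k \<phi>'"
    then have smooth: "smooth_map M N \<phi>" "smooth_map N Q \<phi>'"
      by (auto simp: generalized_harmonic_morphism_def harmonic_morphism_def)
    then have cont: "continuous_map (mtop M) (mtop N) \<phi>" "continuous_map (mtop N) (mtop Q) \<phi>'"
      by (auto simp: smooth_map_def)
    show "generalized_harmonic_morphism M g Q k (\<phi>' \<circ> \<phi>)"
      unfolding generalized_harmonic_morphism_def
    proof (intro conjI allI impI)
      show "smooth_map M Q (\<phi>' \<circ> \<phi>)"
        by (intro smooth_map_comp[of M N] man smooth)
      show "biharmonic_on M g (preimage_in M (\<phi>' \<circ> \<phi>) U) (f \<circ> (\<phi>' \<circ> \<phi>))"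
        if "openin (mtop Q) U" "preimage_in M (\<phi>' \<circ> \<phi>) U \<noteq> {}" "harmonic_on Q k U f" for U f
        by (rule pullback_comp[OF cont, where A = "harmonic_on Q k" and B = "harmonic_on N h"])
           (use \<phi>[unfolded generalized_harmonic_morphism_def]
             \<phi>'[unfolded harmonic_morphism_def] that in blast)+
    qed
  }
  {
    fix \<phi> \<psi>
    assume \<phi>: "generalized_harmonic_morphism M g N h \<phi>" and \<psi>: "biharmonic_morphism Q k M g \<psi>"
    then have smooth: "smooth_map Q M \<psi>" "smooth_map M N \<phi>"
      by (auto simp: generalized_harmonic_morphism_def biharmonic_morphism_def)
    then have cont: "continuous_map (mtop Q) (mtop M) \<psi>" "continuous_map (mtop M) (mtop N) \<phi>"
      by (auto simp: smooth_map_def)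
    show "generalized_harmonic_morphism Q k N h (\<phi> \<circ> \<psi>)"
      unfolding generalized_harmonic_morphism_def
    proof (intro conjI allI impI)
      show "smooth_map Q N (\<phi> \<circ> \<psi>)"
        by (intro smooth_map_comp[of Q M] man smooth)
      show "biharmonic_on Q k (preimage_in Q (\<phi> \<circ> \<psi>) U) (f \<circ> (\<phi> \<circ> \<psi>))"
        if "openin (mtop N) U" "preimage_in Q (\<phi> \<circ> \<psi>) U \<noteq> {}" "harmonic_on N h U f" for U f
        by (rule pullback_comp[OF cont, where A = "harmonic_on N h" and B = "biharmonic_on M g"])
           (use \<phi>[unfolded generalized_harmonic_morphism_def]
             \<psi>[unfolded biharmonic_morphism_def] that in blast)+
    qed
  }
qed

end
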